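(* If $G$ is a finite group satisfying $\mathcal{CD}(G)=[G/Z(G)]$ and $H$ is a subgroup of $G$, then $\mathcal{CD}(H)=[H/Z(H)]$.
   Context: For a finite group $G$, $L(G)$ denotes the lattice of all subgroups of $G$ and $Z(G)$ its center. The Chermak-Delgado measure of a subgroup $K\le G$ is $m_G(K)=|K|\,|C_G(K)|$, where $C_G(K)$ is the centralizer of $K$ in $G$. Put $m(G)=\max\{m_G(K)\mid K\le G\}$ and $\mathcal{CD}(G)=\{K\le G\mid m_G(K)=m(G)\}$ (the Chermak-Delgado lattice of $G$). The interval $[G/Z(G)]$ is $\{K\in L(G)\mid Z(G)\le K\le G\}$. For a subgroup $H$ of $G$, $\mathcal{CD}(H)$ and $[H/Z(H)]$ are formed with respect to $H$ as a group in its own right. *)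

theory Defs
  imports "HOL-Algebra.Group"
begin

definition centralizer :: "('a, 'b) monoid_scheme \<Rightarrow> 'a set \<Rightarrow> 'a set" where
  "centralizer G K = {g \<in> carrier G. \<forall>k\<in>K. g \<otimes>\<^bsub>G\<^esub> k = k \<otimes>\<^bsub>G\<^esub> g}"

definition group_center :: "('a, 'b) monoid_scheme \<Rightarrow> 'a set" where
  "group_center G = {z \<in> carrier G. \<forall>g\<in>carrier G. z \<otimes>\<^bsub>G\<^esub> g = g \<otimes>\<^bsub>G\<^esub> z}"

definition CD_measure :: "('a, 'b) monoid_scheme \<Rightarrow> 'a set \<Rightarrow> nat" where
  "CD_measure G K = card K * card (centralizer G K)"

(* Meaningful for finite G only: Max is unspecified on infinite sets, and card is 0 there. *)
definition max_CD_measure :: "('a, 'b) monoid_scheme \<Rightarrow> nat" where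
  "max_CD_measure G = Max {CD_measure G K | K. subgroup K G}"

definition CD_lattice :: "('a, 'b) monoid_scheme \<Rightarrow> 'a set set" where
  "CD_lattice G = {K. subgroup K G \<and> CD_measure G K = max_CD_measure G}"

(* The interval [G/Z(G)] of the subgroup lattice; its upper end K \<subseteq> carrier G is
   part of subgroup K G. *)
definition center_interval :: "('a, 'b) monoid_scheme \<Rightarrow> 'a set set" where
  "center_interval G = {K. subgroup K G \<and> group_center G \<subseteq> K}"

end

theory Submission
  imports Defs "HOL-Algebra.Coset"
begin

text \<open>
  Write \<open>C\<close> for centralizers in \<open>G\<close> and \<open>Z\<close> for the center of \<open>G\<close>. The equality of the
  Chermak-Delgado lattice with the interval above the center amounts to a single numerical
  condition, which is \<open>CD_lattice_eq_center_interval_iff\<close>: every subgroup \<open>K\<close> containing the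
  center has the measure \<open>|G||Z|\<close> of the whole group. So the hypothesis is
  \<open>|L||C(L)| = |G||Z|\<close> for all \<open>L \<ge> Z\<close>, and the goal is
  \<open>|K||H \<inter> C(K)| = |H||H \<inter> C(H)|\<close> for all \<open>K\<close> with \<open>Z(H) = H \<inter> C(H) \<le> K \<le> H\<close>.

  The idea is to compute the relative centralizer \<open>H \<inter> C(K)\<close> as an absolute one. Constancy of the
  measure forces \<open>C(C(L)) = L\<close> for \<open>L \<ge> Z\<close> (\<open>double_centralizer\<close>), hence \<open>C(C(H)) = HZ\<close>. Since \<open>K\<close>
  commutes with \<open>C(H)\<close>, the product \<open>K C(H)\<close> is a subgroup, and its centralizer is
  \<open>C(K) \<inter> HZ = (H \<inter> C(K)) Z\<close>. Both \<open>K C(H)\<close> and \<open>HZ\<close> contain \<open>Z\<close>, so they have the same measure: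
  \<open>|K C(H)||(H \<inter> C(K)) Z| = |HZ||C(H)|\<close>. The product formula \<open>card_set_mult\<close>, applied to the three
  products, turns this into the goal; it enters that \<open>K \<inter> C(H) = Z(H)\<close> exactly because
  \<open>Z(H) \<le> K \<le> H\<close>, and that \<open>HZ\<close> and \<open>(H \<inter> C(K)) Z\<close> have the same overlap \<open>H \<inter> Z\<close> of their factors.
  This counting is \<open>card_mult_relative_centralizer\<close>.
\<close>

section \<open>Centralizers and centers\<close>

lemma centralizer_restrict:
  assumes "H \<subseteq> carrier G"
  shows "centralizer (G\<lparr>carrier := H\<rparr>) K = H \<inter> centralizer G K"
  using assms by (auto simp: centralizer_def)

lemma group_center_eq_centralizer: "group_center G = centralizer G (carrier G)"
  by (simp add: group_center_def centralizer_def)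

lemma group_center_restrict:
  assumes "H \<subseteq> carrier G"
  shows "group_center (G\<lparr>carrier := H\<rparr>) = H \<inter> centralizer G H"
  using assms by (auto simp: group_center_def centralizer_def)

lemma centralizer_antimono: "A \<subseteq> B \<Longrightarrow> centralizer G B \<subseteq> centralizer G A"
  by (auto simp: centralizer_def)

lemma center_subset_centralizer:
  "K \<subseteq> carrier G \<Longrightarrow> group_center G \<subseteq> centralizer G K"
  by (simp add: group_center_eq_centralizer centralizer_antimono)

lemma subset_centralizer_sym:
  assumes "A \<subseteq> centralizer G B" and "B \<subseteq> carrier G"
  shows "B \<subseteq> centralizer G A"
  using assms by (fastforce simp: centralizer_def)

context group
begin

lemma subgroup_centralizer:
  assumes "K \<subseteq> carrier G"
  shows "subgroup (centralizer G K) G"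
proof (rule subgroupI)
  show "centralizer G K \<subseteq> carrier G"
    by (auto simp: centralizer_def)
  have "\<one> \<in> centralizer G K"
    using assms by (auto simp: centralizer_def)
  then show "centralizer G K \<noteq> {}"
    by blast
next
  fix a assume a: "a \<in> centralizer G K"
  have "inv a \<otimes> k = k \<otimes> inv a" if "k \<in> K" for k
  proof -
    have "a \<in> carrier G" "k \<in> carrier G" "a \<otimes> k = k \<otimes> a"
      using a that assms by (auto simp: centralizer_def)
    then show ?thesis
      by (metis inv_closed inv_solve_left inv_solve_right m_assoc m_closed)
  qed
  then show "inv a \<in> centralizer G K"
    using a by (simp add: centralizer_def)
next
  fix a b assume ab: "a \<in> centralizer G K" "b \<in> centralizer G K"
  have "a \<otimes> b \<otimes> k = k \<otimes> (a \<otimes> b)" if "k \<in> K" for k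
  proof -
    have "a \<in> carrier G" "b \<in> carrier G" "k \<in> carrier G" "a \<otimes> k = k \<otimes> a" "b \<otimes> k = k \<otimes> b"
      using ab that assms by (auto simp: centralizer_def)
    then show ?thesis
      by (metis m_assoc)
  qed
  then show "a \<otimes> b \<in> centralizer G K"
    using ab by (simp add: centralizer_def)
qed

lemma subgroup_center: "subgroup (group_center G) G"
  by (simp add: group_center_eq_centralizer subgroup_centralizer)

section \<open>Products of subgroups\<close>

lemma subset_set_mult_left:
  assumes "A \<subseteq> carrier G" and "subgroup B G"
  shows "A \<subseteq> A <#> B"
proof
  fix a assume "a \<in> A"
  then have "a \<otimes> \<one> \<in> A <#> B"
    using subgroup.one_closed[OF assms(2)] by (auto simp: set_mult_def)
  then show "a \<in> A <#> B"
    using \<open>a \<in> A\<close> assms(1) by auto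
qed

lemma subset_set_mult_right:
  assumes "subgroup A G" and "B \<subseteq> carrier G"
  shows "B \<subseteq> A <#> B"
proof
  fix b assume "b \<in> B"
  then have "\<one> \<otimes> b \<in> A <#> B"
    using subgroup.one_closed[OF assms(1)] unfolding set_mult_def by blast
  then show "b \<in> A <#> B"
    using \<open>b \<in> B\<close> assms(2) by auto
qed

lemma subgroup_set_mult_commuting:
  assumes A: "subgroup A G" and B: "subgroup B G" and comm: "B \<subseteq> centralizer G A"
  shows "subgroup (A <#> B) G"
proof (rule subgroupI)
  note sub = subgroup.subset[OF A] subgroup.subset[OF B]
  have ba: "b \<otimes> a = a \<otimes> b" if "a \<in> A" "b \<in> B" for a b
    using comm that by (auto simp: centralizer_def)
  show "A <#> B \<subseteq> carrier G"
    using sub by (rule setmult_subset_G)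
  show "A <#> B \<noteq> {}"
    using subset_set_mult_left[OF sub(1) B] subgroup.one_closed[OF A] by blast
  show "inv x \<in> A <#> B" if "x \<in> A <#> B" for x
  proof -
    obtain a b where x: "a \<in> A" "b \<in> B" "x = a \<otimes> b"
      using \<open>x \<in> A <#> B\<close> by (auto simp: set_mult_def)
    have "inv x = inv (b \<otimes> a)"
      using x ba by simp
    also have "\<dots> = inv a \<otimes> inv b"
      using x sub by (intro inv_mult_group) auto
    finally show ?thesis
      using x subgroup.m_inv_closed[OF A] subgroup.m_inv_closed[OF B]
      by (auto simp: set_mult_def)
  qed
  show "x \<otimes> y \<in> A <#> B" if "x \<in> A <#> B" "y \<in> A <#> B" for x y
  proof -
    obtain a b where x: "a \<in> A" "b \<in> B" "x = a \<otimes> b"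
      using \<open>x \<in> A <#> B\<close> by (auto simp: set_mult_def)
    obtain a' b' where y: "a' \<in> A" "b' \<in> B" "y = a' \<otimes> b'"
      using \<open>y \<in> A <#> B\<close> by (auto simp: set_mult_def)
    have c: "a \<in> carrier G" "b \<in> carrier G" "a' \<in> carrier G" "b' \<in> carrier G"
      using x y sub by auto
    have "x \<otimes> y = a \<otimes> (b \<otimes> a') \<otimes> b'"
      using x y c by (simp add: m_assoc)
    also have "\<dots> = (a \<otimes> a') \<otimes> (b \<otimes> b')"
      using x y c by (simp add: ba m_assoc)
    finally show ?thesis
      using x y subgroup.m_closed[OF A] subgroup.m_closed[OF B]
      by (simp add: set_mult_def) blast
  qed
qed

lemma centralizer_set_mult:
  assumes A: "subgroup A G" and B: "subgroup B G"
  shows "centralizer G (A <#> B) = centralizer G A \<inter> centralizer G B"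
proof (intro equalityI Int_greatest)
  note sub = subgroup.subset[OF A] subgroup.subset[OF B]
  show "centralizer G (A <#> B) \<subseteq> centralizer G A"
    by (rule centralizer_antimono) (rule subset_set_mult_left[OF sub(1) B])
  show "centralizer G (A <#> B) \<subseteq> centralizer G B"
    by (rule centralizer_antimono) (rule subset_set_mult_right[OF A sub(2)])
  show "centralizer G A \<inter> centralizer G B \<subseteq> centralizer G (A <#> B)"
  proof
    fix g assume g: "g \<in> centralizer G A \<inter> centralizer G B"
    have "g \<otimes> (a \<otimes> b) = a \<otimes> b \<otimes> g" if "a \<in> A" "b \<in> B" for a b
    proof -
      have "g \<in> carrier G" "a \<in> carrier G" "b \<in> carrier G" "g \<otimes> a = a \<otimes> g" "g \<otimes> b = b \<otimes> g"
        using g that sub by (auto simp: centralizer_def)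
      then show ?thesis
        by (metis m_assoc)
    qed
    then show "g \<in> centralizer G (A <#> B)"
      using g by (auto simp: centralizer_def set_mult_def)
  qed
qed

text \<open>
  The multiplication map \<open>A \<times> B \<rightarrow> AB\<close> has fibres of constant size: over \<open>ab\<close> the pairs are
  \<open>(ac, c\<^sup>-\<^sup>1b)\<close> with \<open>c \<in> A \<inter> B\<close>.
\<close>

lemma card_set_mult:
  assumes A: "subgroup A G" and B: "subgroup B G" and fin: "finite A" "finite B"
  shows "card (A <#> B) * card (A \<inter> B) = card A * card B"
proof -
  note sub = subgroup.subset[OF A] subgroup.subset[OF B]
  define fib where "fib x = {p \<in> A \<times> B. fst p \<otimes> snd p = x}" for x
  have AB: "A <#> B = (\<lambda>p. fst p \<otimes> snd p) ` (A \<times> B)"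
    by (force simp: set_mult_def)
  have fib: "card (fib x) = card (A \<inter> B)" if "x \<in> A <#> B" for x
  proof -
    obtain a b where ab: "a \<in> A" "b \<in> B" and x: "x = a \<otimes> b"
      using \<open>x \<in> A <#> B\<close> by (auto simp: set_mult_def)
    have c: "a \<in> carrier G" "b \<in> carrier G"
      using ab sub by auto
    have "bij_betw (\<lambda>c. (a \<otimes> c, inv c \<otimes> b)) (A \<inter> B) (fib x)"
    proof (rule bij_betwI[where g = "\<lambda>p. inv a \<otimes> fst p"])
      show "(\<lambda>c. (a \<otimes> c, inv c \<otimes> b)) \<in> A \<inter> B \<rightarrow> fib x"
      proof
        fix d assume d: "d \<in> A \<inter> B"
        then have dc: "d \<in> carrier G"
          using sub by auto
        have "a \<otimes> d \<otimes> (inv d \<otimes> b) = a \<otimes> (d \<otimes> inv d) \<otimes> b"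
          using c dc by (simp only: m_assoc m_closed inv_closed)
        then have "a \<otimes> d \<otimes> (inv d \<otimes> b) = x"
          using c dc x by simp
        then show "(a \<otimes> d, inv d \<otimes> b) \<in> fib x"
          using ab d A B by (simp add: fib_def subgroup.m_closed subgroup.m_inv_closed)
      qed
      show "(\<lambda>p. inv a \<otimes> fst p) \<in> fib x \<rightarrow> A \<inter> B"
      proof
        fix p assume "p \<in> fib x"
        then obtain a' b' where p: "p = (a', b')" "a' \<in> A" "b' \<in> B" and eq: "a' \<otimes> b' = a \<otimes> b"
          by (cases p) (auto simp: fib_def x)
        have c': "a' \<in> carrier G" "b' \<in> carrier G"
          using p sub by auto
        \<comment> \<open>the left side lies in \<open>A\<close>, the right side in \<open>B\<close>\<close>
        have "inv a \<otimes> a' = b \<otimes> inv b'"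
          using c c' eq by (metis inv_closed inv_solve_left inv_solve_right m_assoc m_closed)
        moreover have "inv a \<otimes> a' \<in> A" "b \<otimes> inv b' \<in> B"
          using p ab A B by (auto intro: subgroup.m_closed subgroup.m_inv_closed)
        ultimately show "inv a \<otimes> fst p \<in> A \<inter> B"
          using p by simp
      qed
      show "inv a \<otimes> fst (a \<otimes> d, inv d \<otimes> b) = d" if "d \<in> A \<inter> B" for d
        using c that sub by (simp add: m_assoc[symmetric] subsetD)
      show "(a \<otimes> (inv a \<otimes> fst p), inv (inv a \<otimes> fst p) \<otimes> b) = p" if "p \<in> fib x" for p
      proof -
        obtain a' b' where p: "p = (a', b')" "a' \<in> A" "b' \<in> B" and eq: "a' \<otimes> b' = a \<otimes> b"
          using \<open>p \<in> fib x\<close> by (cases p) (auto simp: fib_def x)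
        have c': "a' \<in> carrier G" "b' \<in> carrier G"
          using p sub by auto
        have "inv (inv a \<otimes> a') \<otimes> b = inv a' \<otimes> (a \<otimes> b)"
          using c c' by (simp add: inv_mult_group m_assoc)
        also have "\<dots> = b'"
          using c c' by (simp add: eq[symmetric] m_assoc[symmetric])
        finally show ?thesis
          using p c c' by (simp add: m_assoc[symmetric])
      qed
    qed
    then show ?thesis
      by (simp add: bij_betw_same_card)
  qed
  have "card A * card B = (\<Sum>p\<in>A \<times> B. 1)"
    by (simp add: card_cartesian_product)
  also have "\<dots> = (\<Sum>x\<in>A <#> B. \<Sum>p\<in>fib x. 1)"
    unfolding AB fib_def using fin by (intro sum.image_gen) simp
  also have "\<dots> = card (A <#> B) * card (A \<inter> B)"
    by (simp add: fib)
  finally show ?thesis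
    by simp
qed

section \<open>Groups whose Chermak-Delgado lattice is the interval above the center\<close>

text \<open>
  The whole group lies in the interval, so equality forces the maximum to be its measure. For the
  converse, a subgroup \<open>K\<close> that does not contain the center is never optimal: adjoining the
  center enlarges \<open>K\<close> without changing its centralizer.
\<close>

lemma CD_lattice_eq_center_interval_iff:
  assumes fin: "finite (carrier G)"
  shows "CD_lattice G = center_interval G \<longleftrightarrow>
    (\<forall>K. subgroup K G \<longrightarrow> group_center G \<subseteq> K \<longrightarrow>
      CD_measure G K = card (carrier G) * card (group_center G))"
    (is "_ \<longleftrightarrow> ?const")
proof
  have carrier: "carrier G \<in> center_interval G"
    by (auto simp: center_interval_def group_center_def subgroup_self)
  have measure_carrier: "CD_measure G (carrier G) = card (carrier G) * card (group_center G)"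
    by (simp add: CD_measure_def group_center_eq_centralizer)
  {
    assume eq: "CD_lattice G = center_interval G"
    have "max_CD_measure G = card (carrier G) * card (group_center G)"
      using carrier measure_carrier unfolding eq[symmetric] by (simp add: CD_lattice_def)
    moreover have "CD_measure G K = max_CD_measure G"
      if "subgroup K G" "group_center G \<subseteq> K" for K
    proof -
      have "K \<in> CD_lattice G"
        using that by (simp add: eq center_interval_def)
      then show ?thesis
        by (simp add: CD_lattice_def)
    qed
    ultimately show ?const
      by simp
  }
  assume const: ?const
  let ?Z = "group_center G"
  have Z: "subgroup ?Z G"
    by (rule subgroup_center)
  have bound: "CD_measure G K < card (carrier G) * card ?Z"
    if K: "subgroup K G" and notle: "\<not> ?Z \<subseteq> K" for K
  proof -
    note KG = subgroup.subset[OF K]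
    have sub: "subgroup (K <#> ?Z) G"
      using K Z center_subset_centralizer[OF KG] by (rule subgroup_set_mult_commuting)
    have le: "K \<subseteq> K <#> ?Z" "?Z \<subseteq> K <#> ?Z"
      using KG K Z subgroup.subset[OF Z]
      by (auto intro: subset_set_mult_left[THEN subsetD] subset_set_mult_right[THEN subsetD])
    have "centralizer G ?Z = carrier G"
      by (auto simp: centralizer_def group_center_def)
    then have cent: "centralizer G (K <#> ?Z) = centralizer G K"
      using subgroup.subset[OF subgroup_centralizer[OF KG]]
      by (simp add: centralizer_set_mult[OF K Z] Int_absorb2)
    have "K \<subset> K <#> ?Z"
      using le notle by blast
    then have "card K < card (K <#> ?Z)"
      using finite_subset[OF subgroup.subset[OF sub] fin] by (intro psubset_card_mono)
    moreover have "0 < card (centralizer G K)"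
      using subgroup_centralizer[OF KG] fin subgroup.subset
      by (metis card_gt_0_iff empty_iff finite_subset subgroup.one_closed)
    ultimately have "CD_measure G K < CD_measure G (K <#> ?Z)"
      by (simp add: CD_measure_def cent)
    also have "\<dots> = card (carrier G) * card ?Z"
      using const sub le by blast
    finally show ?thesis .
  qed
  have "max_CD_measure G = card (carrier G) * card ?Z"
    unfolding max_CD_measure_def
  proof (rule Max_eqI)
    have "{K. subgroup K G} \<subseteq> Pow (carrier G)"
      using subgroup.subset by blast
    then have "finite {K. subgroup K G}"
      using fin by (meson finite_Pow_iff finite_subset)
    then show "finite {CD_measure G K |K. subgroup K G}"
      by simp
    show "y \<le> card (carrier G) * card ?Z" if "y \<in> {CD_measure G K |K. subgroup K G}" for y
      using that bound const by (force intro: less_imp_le)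
    show "card (carrier G) * card ?Z \<in> {CD_measure G K |K. subgroup K G}"
      using measure_carrier subgroup_self by (metis (mono_tags, lifting) mem_Collect_eq)
  qed
  then show "CD_lattice G = center_interval G"
    using bound const by (force simp: CD_lattice_def center_interval_def)
qed

text \<open>
  Both \<open>K\<close> and its centralizer contain the center, so they have equal measure. Cancelling the
  order of the centralizer shows that \<open>K\<close> and its double centralizer have the same order, and one
  contains the other.
\<close>

lemma double_centralizer:
  assumes fin: "finite (carrier G)"
    and const: "\<And>L. subgroup L G \<Longrightarrow> group_center G \<subseteq> L \<Longrightarrow> CD_measure G L = m"
    and K: "subgroup K G" and ZK: "group_center G \<subseteq> K"
  shows "centralizer G (centralizer G K) = K"
proof -
  let ?C = "centralizer G"
  note KG = subgroup.subset[OF K]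
  have C: "subgroup (?C K) G"
    using KG by (rule subgroup_centralizer)
  note CG = subgroup.subset[OF C]
  have CC: "subgroup (?C (?C K)) G"
    using CG by (rule subgroup_centralizer)
  have "card K * card (?C K) = card (?C K) * card (?C (?C K))"
    using const[OF K ZK] const[OF C center_subset_centralizer[OF KG]]
    by (simp add: CD_measure_def)
  moreover have "0 < card (?C K)"
    using C fin CG by (metis card_gt_0_iff empty_iff finite_subset subgroup.one_closed)
  ultimately have "card K = card (?C (?C K))"
    by simp
  moreover have "K \<subseteq> ?C (?C K)"
    by (rule subset_centralizer_sym[OF subset_refl KG])
  moreover have "finite (?C (?C K))"
    using finite_subset[OF subgroup.subset[OF CC] fin] .
  ultimately show ?thesis
    by (metis card_subset_eq)
qed

text \<open>
  The conclusion is the condition of \<open>CD_lattice_eq_center_interval_iff\<close> for the group \<open>H\<close>, expressed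
  by centralizers in \<open>G\<close>. The subgroup \<open>H\<close> need not contain the center of \<open>G\<close>, so the measure of
  \<open>G\<close> is compared at \<open>HZ\<close> and \<open>K C(H)\<close>, which do contain it.
\<close>

lemma card_mult_relative_centralizer:
  assumes fin: "finite (carrier G)"
    and const: "\<And>L. subgroup L G \<Longrightarrow> group_center G \<subseteq> L \<Longrightarrow> CD_measure G L = m"
    and H: "subgroup H G" and K: "subgroup K G" and KH: "K \<subseteq> H"
    and ZHK: "H \<inter> centralizer G H \<subseteq> K"
  shows "card K * card (H \<inter> centralizer G K) = card H * card (H \<inter> centralizer G H)"
proof -
  let ?C = "centralizer G" and ?Z = "group_center G"
  note HG = subgroup.subset[OF H] and KG = subgroup.subset[OF K]
  have Z: "subgroup ?Z G"
    by (rule subgroup_center)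
  note ZG = subgroup.subset[OF Z]
  have CZ: "?C ?Z = carrier G"
    by (auto simp: centralizer_def group_center_def)
  have CH: "subgroup (?C H) G" and CK: "subgroup (?C K) G"
    using HG KG by (auto intro: subgroup_centralizer)
  have fins: "finite L" if "subgroup L G" for L
    using finite_subset[OF subgroup.subset[OF that] fin] .
  have pos: "0 < card L" if "subgroup L G" for L
    using fins[OF that] subgroup.one_closed[OF that] by (auto simp: card_gt_0_iff)
  have D: "subgroup (H \<inter> ?C K) G"
    using H CK by (rule subgroups_Inter_pair)

  have HZ: "subgroup (H <#> ?Z) G"
    using H Z center_subset_centralizer[OF HG] by (rule subgroup_set_mult_commuting)
  have Z_HZ: "?Z \<subseteq> H <#> ?Z"
    using H ZG by (rule subset_set_mult_right)
  have C_HZ: "?C (H <#> ?Z) = ?C H"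
    using subgroup.subset[OF CH] by (simp add: centralizer_set_mult[OF H Z] CZ Int_absorb2)
  have CCH: "?C (?C H) = H <#> ?Z"
    using double_centralizer[OF fin const HZ Z_HZ] by (simp add: C_HZ)

  have KCH: "subgroup (K <#> ?C H) G"
    using K CH centralizer_antimono[OF KH] by (rule subgroup_set_mult_commuting)
  have Z_KCH: "?Z \<subseteq> K <#> ?C H"
    using center_subset_centralizer[OF HG] subset_set_mult_right[OF K subgroup.subset[OF CH]]
    by blast
  have K_CH: "K \<inter> ?C H = H \<inter> ?C H"
    using KH ZHK by blast

  \<comment> \<open>Dedekind's modular law, as the center lies in the centralizer of \<open>K\<close>\<close>
  have C_KCH: "?C (K <#> ?C H) = (H \<inter> ?C K) <#> ?Z"
  proof -
    have "?C (K <#> ?C H) = ?C K \<inter> (H <#> ?Z)"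
      by (simp add: centralizer_set_mult[OF K CH] CCH)
    also have "\<dots> = (H \<inter> ?C K) <#> ?Z"
    proof (intro equalityI subsetI)
      fix x assume x: "x \<in> ?C K \<inter> (H <#> ?Z)"
      then obtain h z where hz: "h \<in> H" "z \<in> ?Z" "x = h \<otimes> z"
        by (auto simp: set_mult_def)
      have c: "h \<in> carrier G" "z \<in> carrier G"
        using hz HG ZG by auto
      have "z \<in> ?C K"
        using hz center_subset_centralizer[OF KG] by blast
      then have "x \<otimes> inv z \<in> ?C K"
        using x CK by (simp add: subgroup.m_closed subgroup.m_inv_closed)
      also have "x \<otimes> inv z = h"
        using hz c by (simp add: m_assoc)
      finally show "x \<in> (H \<inter> ?C K) <#> ?Z"
        using hz by (auto simp: set_mult_def)
    next
      fix x assume "x \<in> (H \<inter> ?C K) <#> ?Z"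
      then obtain h z where hz: "h \<in> H" "h \<in> ?C K" "z \<in> ?Z" "x = h \<otimes> z"
        by (auto simp: set_mult_def)
      moreover have "z \<in> ?C K"
        using hz center_subset_centralizer[OF KG] by blast
      ultimately show "x \<in> ?C K \<inter> (H <#> ?Z)"
        using CK by (auto simp: set_mult_def subgroup.m_closed)
    qed
    finally show ?thesis .
  qed

  have "card (K <#> ?C H) * card ((H \<inter> ?C K) <#> ?Z) = card (H <#> ?Z) * card (?C H)"
    using const[OF KCH Z_KCH] const[OF HZ Z_HZ] by (simp add: CD_measure_def C_KCH C_HZ)
  moreover have "card (K <#> ?C H) * card (H \<inter> ?C H) = card K * card (?C H)"
    using card_set_mult[OF K CH] fins[OF K] fins[OF CH] by (simp add: K_CH)
  moreover have "card (H <#> ?Z) * card (H \<inter> ?Z) = card H * card ?Z"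
    using card_set_mult[OF H Z] fins[OF H] fins[OF Z] by simp
  moreover have "card ((H \<inter> ?C K) <#> ?Z) * card (H \<inter> ?Z) = card (H \<inter> ?C K) * card ?Z"
  proof -
    have "H \<inter> ?C K \<inter> ?Z = H \<inter> ?Z"
      using center_subset_centralizer[OF KG] by blast
    then show ?thesis
      using card_set_mult[OF D Z] fins[OF D] fins[OF Z] by simp
  qed
  ultimately have "(card K * card (H \<inter> ?C K)) * (card (?C H) * card ?Z)
      = (card H * card (H \<inter> ?C H)) * (card (?C H) * card ?Z)"
    by algebra
  then show ?thesis
    using pos[OF CH] pos[OF Z] by simp
qed

end

theorem corollary4:
  fixes G :: "('a, 'b) monoid_scheme" and H :: "'a set"
  assumes "group G"
    and "finite (carrier G)"
    and "CD_lattice G = center_interval G"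
    and "subgroup H G"
  shows "CD_lattice (G\<lparr>carrier := H\<rparr>) = center_interval (G\<lparr>carrier := H\<rparr>)"
proof -
  interpret group G
    by fact
  let ?GH = "G\<lparr>carrier := H\<rparr>" and ?m = "card (carrier G) * card (group_center G)"
  note HG = subgroup.subset[OF \<open>subgroup H G\<close>]
  interpret GH: group ?GH
    using \<open>subgroup H G\<close> by (rule subgroup_imp_group)
  have const: "CD_measure G L = ?m" if "subgroup L G" "group_center G \<subseteq> L" for L
    using assms(3) that CD_lattice_eq_center_interval_iff[OF assms(2)] by blast
  have "CD_measure ?GH K = card (carrier ?GH) * card (group_center ?GH)"
    if K: "subgroup K ?GH" and ZK: "group_center ?GH \<subseteq> K" for K
  proof -
    have "subgroup K G"
      using incl_subgroup[OF \<open>subgroup H G\<close> K] .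
    moreover have "K \<subseteq> H"
      using subgroup.subset[OF K] by simp
    moreover have "H \<inter> centralizer G H \<subseteq> K"
      using ZK by (simp add: group_center_restrict[OF HG])
    ultimately have "card K * card (H \<inter> centralizer G K) = card H * card (H \<inter> centralizer G H)"
      using card_mult_relative_centralizer[OF assms(2) const \<open>subgroup H G\<close>] by blast
    then show ?thesis
      by (simp add: CD_measure_def centralizer_restrict[OF HG] group_center_restrict[OF HG])
  qed
  moreover have "finite (carrier ?GH)"
    using finite_subset[OF HG assms(2)] by simp
  ultimately show ?thesis
    using GH.CD_lattice_eq_center_interval_iff by blast
qed

end
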